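(* Let $F$ and $m$ be positive integers and let $S\in\mathscr{R}(F,m)$. Then $S\in\mathrm{Max}(\mathscr{R}(F,m))$ if and only if one of the following conditions holds: 1. $F=m-1$ and $\mathrm{g}(S)=m-1$; 2. $m<F<2m$ and $\mathrm{g}(S)=m$; 3. $F>2m$ and $\mathrm{g}(S)=\left\lceil\frac{F+1}{2}\right\rceil$.
   Context: A numerical semigroup is a submonoid $S$ of $(\mathbb{N},+)$ ($\mathbb{N}$ the nonnegative integers) with $\mathbb{N}\setminus S$ finite. Its genus $\mathrm{g}(S)$ is the cardinality of $\mathbb{N}\setminus S$, its Frobenius number $\mathrm{F}(S)$ is the largest integer not in $S$, and its multiplicity is $\mathrm{m}(S)=\min(S\setminus\{0\})$. $\mathscr{R}(F,m)$ denotes the set of numerical semigroups $S$ with $\mathrm{F}(S)=F$ and $\mathrm{m}(S)=m$, and $\mathrm{Max}(\mathscr{R}(F,m))$ is the set of its maximal elements with respect to inclusion. *)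

theory Defs
  imports Complex_Main
begin

definition numerical_semigroup :: "nat set \<Rightarrow> bool" where
  "numerical_semigroup S \<longleftrightarrow>
     0 \<in> S \<and> (\<forall>x\<in>S. \<forall>y\<in>S. x + y \<in> S) \<and> finite (- S)"

definition genus :: "nat set \<Rightarrow> nat" where
  "genus S = card (- S)"

(* The maximum is over all integers outside S, so the semigroup of all natural numbers
   gets the value -1. *)
definition frobenius_number :: "nat set \<Rightarrow> int" where
  "frobenius_number S = (GREATEST z. z \<notin> int ` S)"

definition multiplicity_of :: "nat set \<Rightarrow> nat" where
  "multiplicity_of S = (LEAST n. n \<in> S - {0})"

definition semigroups_with :: "nat \<Rightarrow> nat \<Rightarrow> nat set set" where
  "semigroups_with F m =
     {S. numerical_semigroup S \<and> frobenius_number S = int F \<and> multiplicity_of S = m}"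

definition maximal_elements :: "'a set set \<Rightarrow> 'a set set" where
  "maximal_elements \<R> = {S \<in> \<R>. \<forall>T\<in>\<R>. S \<subseteq> T \<longrightarrow> T = S}"

end

theory Submission imports Defs begin

text \<open>Comparable semigroups with the same genus are equal, since their sets of gaps are finite.
So it is enough to find the genus of the maximal elements. A member \<open>S\<close> of
\<open>\<R>(F, m)\<close> satisfies \<open>F \<ge> m - 1\<close>, and \<open>F\<close> is not a multiple of
\<open>m\<close>; hence either \<open>F < 2m\<close> or \<open>F > 2m\<close>.

If \<open>F < 2m\<close>, then \<open>{0, m, m + 1, \<dots>} - {F}\<close> is closed under addition, because
a sum of two nonzero members is at least \<open>2m > F\<close>. It therefore is the greatest element of
\<open>\<R>(F, m)\<close>, and its gaps are \<open>1, \<dots>, m - 1\<close> and \<open>F\<close>.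

If \<open>F > 2m\<close>, the reflection \<open>x \<mapsto> F - x\<close> decides. It sends members to gaps, which gives
\<open>2 g(S) \<ge> F + 1\<close>, so that a semigroup attaining the least possible genus is maximal
(lemma \<open>genus_lower_bound\<close>). Conversely, suppose that some pair \<open>{x, F - x}\<close> with
\<open>2x \<noteq> F\<close> consists of gaps. The largest such \<open>x\<close> can be adjoined to \<open>S\<close>
(lemma \<open>adjoin_largest_unpaired_gap\<close>). As \<open>x > F / 2 > m\<close>, this changes neither the
multiplicity nor the Frobenius number, and \<open>S\<close> is not maximal. In a maximal \<open>S\<close> the
reflection thus exchanges members and gaps, apart from the midpoint \<open>F / 2\<close> when \<open>F\<close> is
even, and counting gives the genus (lemma \<open>genus_of_paired\<close>).\<close>

section \<open>Frobenius number and multiplicity as first-order conditions\<close>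

lemma frobenius_number_eq_iff:
  assumes "numerical_semigroup S"
  shows "frobenius_number S = int F \<longleftrightarrow> F \<notin> S \<and> (\<forall>n>F. n \<in> S)"
proof
  assume R: "F \<notin> S \<and> (\<forall>n>F. n \<in> S)"
  show "frobenius_number S = int F"
    unfolding frobenius_number_def
  proof (rule Greatest_equality)
    show "int F \<notin> int ` S" using R by auto
    fix z assume z: "z \<notin> int ` S"
    show "z \<le> int F"
    proof (rule ccontr)
      assume "\<not> z \<le> int F"
      then have "nat z \<in> S" "int (nat z) = z" using R by auto
      then show False using z by (metis imageI)
    qed
  qed
next
  assume L: "frobenius_number S = int F"
  have fin: "finite (- S)" using assms by (simp add: numerical_semigroup_def)
  have ne: "- S \<noteq> {}"
  proof
    assume "- S = {}"
    then have S: "S = UNIV" by auto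
    have "frobenius_number S = - 1"
      unfolding frobenius_number_def
    proof (rule Greatest_equality)
      show "- 1 \<notin> int ` S" by auto
      fix z assume z: "z \<notin> int ` S"
      show "z \<le> - 1"
      proof (rule ccontr)
        assume "\<not> z \<le> - 1"
        then have "int (nat z) = z" by simp
        then show False using z S by (metis UNIV_I imageI)
      qed
    qed
    with L show False by simp
  qed
  let ?M = "Max (- S)"
  have M: "?M \<notin> S" using Max_in[OF fin ne] by simp
  have gt: "n \<in> S" if "n > ?M" for n
    using Max_ge[OF fin, of n] that by fastforce
  have "frobenius_number S = int ?M"
    unfolding frobenius_number_def
  proof (rule Greatest_equality)
    show "int ?M \<notin> int ` S" using M by auto
    fix z assume z: "z \<notin> int ` S"
    show "z \<le> int ?M"
    proof (rule ccontr)
      assume "\<not> z \<le> int ?M"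
      then have "nat z \<in> S" "int (nat z) = z" using gt by auto
      then show False using z by (metis imageI)
    qed
  qed
  then show "F \<notin> S \<and> (\<forall>n>F. n \<in> S)" using L M gt by simp
qed

lemma multiplicity_of_eq_iff:
  assumes "numerical_semigroup S"
  shows "multiplicity_of S = m \<longleftrightarrow> m \<in> S \<and> 0 < m \<and> (\<forall>n\<in>S. 0 < n \<longrightarrow> m \<le> n)"
proof -
  have "infinite S"
    using assms finite_compl[of S] by (auto simp: numerical_semigroup_def)
  then have "\<exists>n. n \<in> S - {0}"
    by (metis all_not_in_conv finite.emptyI finite_Diff2 finite.insertI)
  then have "multiplicity_of S \<in> S - {0}"
    unfolding multiplicity_of_def by (rule LeastI_ex)
  moreover have "multiplicity_of S \<le> n" if "n \<in> S" "0 < n" for n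
    unfolding multiplicity_of_def using that by (intro Least_le) auto
  ultimately show ?thesis by (auto intro: antisym)
qed

lemma semigroups_with_iff:
  "S \<in> semigroups_with F m \<longleftrightarrow>
     numerical_semigroup S \<and> F \<notin> S \<and> (\<forall>n>F. n \<in> S) \<and>
     m \<in> S \<and> 0 < m \<and> (\<forall>n\<in>S. 0 < n \<longrightarrow> m \<le> n)"
  unfolding semigroups_with_def
  by (auto simp: frobenius_number_eq_iff multiplicity_of_eq_iff cong: conj_cong)

lemma frobenius_pos:
  assumes "S \<in> semigroups_with F m"
  shows "0 < F"
  using assms by (metis gr0I numerical_semigroup_def semigroups_with_iff)

lemma gap_le_frobenius:
  assumes "S \<in> semigroups_with F m" "x \<notin> S"
  shows "x \<le> F"
  using assms by (meson semigroups_with_iff not_less)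

lemma frobenius_not_multiple:
  assumes S: "S \<in> semigroups_with F m"
  shows "\<not> m dvd F"
proof
  assume "m dvd F"
  then obtain k where F: "F = m * k" ..
  have "m * j \<in> S" for j
    using S by (induction j) (auto simp: semigroups_with_iff numerical_semigroup_def)
  then show False using S F by (auto simp: semigroups_with_iff)
qed

lemma frobenius_ge:
  assumes S: "S \<in> semigroups_with F m"
  shows "m \<le> F + 1"
  using S by (auto simp: semigroups_with_iff)

lemma eq_if_subset_if_genus_eq:
  assumes "numerical_semigroup S" "S \<subseteq> T" "genus T = genus S"
  shows "T = S"
proof -
  have "- T = - S"
    using assms by (intro card_subset_eq) (auto simp: numerical_semigroup_def genus_def)
  then show ?thesis by simp
qed

section \<open>Small Frobenius number: a greatest element\<close>

lemma greatest_of_small_frobenius: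
  assumes S: "S \<in> semigroups_with F m" and "F < 2 * m"
  defines "T \<equiv> insert 0 ({m..} - {F})"
  shows "T \<in> semigroups_with F m" and "\<And>S'. S' \<in> semigroups_with F m \<Longrightarrow> S' \<subseteq> T"
proof -
  have m: "0 < m" "F \<noteq> m" "m \<le> F + 1" "0 < F"
    using S frobenius_ge[OF S] frobenius_pos[OF S] by (auto simp: semigroups_with_iff)
  have "finite (- T)"
    by (rule finite_subset[of _ "{..<m} \<union> {F}"]) (auto simp: T_def)
  moreover have "x + y \<in> T" if "x \<in> T" "y \<in> T" for x y
    using that \<open>F < 2 * m\<close> by (auto simp: T_def)
  ultimately have "numerical_semigroup T"
    by (auto simp: numerical_semigroup_def T_def)
  then show "T \<in> semigroups_with F m"
    using m by (auto simp: semigroups_with_iff T_def)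
  show "S' \<subseteq> T" if "S' \<in> semigroups_with F m" for S'
    using that by (auto simp: semigroups_with_iff T_def)
qed

lemma genus_of_greatest:
  assumes "0 < m" "F \<noteq> m" "m \<le> F + 1" "0 < F"
  shows "genus (insert 0 ({m..} - {F})) = (if F = m - 1 then m - 1 else m)"
proof -
  have "- insert 0 ({m..} - {F}) = insert F {1..<m}" using assms by auto
  then have "genus (insert 0 ({m..} - {F})) = card (insert F {1..<m})"
    by (simp only: genus_def)
  also have "\<dots> = (if F \<in> {1..<m} then m - 1 else Suc (m - 1))"
    by (simp add: card_insert_if)
  also have "\<dots> = (if F = m - 1 then m - 1 else m)"
    using assms by (cases "F = m - 1") auto
  finally show ?thesis .
qed

lemma maximal_iff_genus_of_small_frobenius:
  assumes S: "S \<in> semigroups_with F m" and "F < 2 * m"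
  shows "S \<in> maximal_elements (semigroups_with F m) \<longleftrightarrow>
           genus S = (if F = m - 1 then m - 1 else m)"
proof -
  let ?T = "insert 0 ({m..} - {F})"
  note T = greatest_of_small_frobenius[OF S \<open>F < 2 * m\<close>]
  have "0 < m" "F \<noteq> m" using S by (auto simp: semigroups_with_iff)
  then have g: "genus ?T = (if F = m - 1 then m - 1 else m)"
    using frobenius_ge[OF S] frobenius_pos[OF S] by (rule genus_of_greatest)
  have "S \<in> maximal_elements (semigroups_with F m) \<longleftrightarrow> ?T = S"
    using S T unfolding maximal_elements_def by blast
  also have "\<dots> \<longleftrightarrow> genus ?T = genus S"
    using S T(2)[OF S] eq_if_subset_if_genus_eq[of S ?T] by (auto simp: semigroups_with_iff)
  finally show ?thesis using g by auto
qed

section \<open>The reflection in the Frobenius number\<close>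

lemma genus_plus_small_members:
  assumes S: "S \<in> semigroups_with F m"
  shows "genus S + card (S \<inter> {..F}) = F + 1"
proof -
  have fin: "finite (- S)"
    using S by (simp add: semigroups_with_iff numerical_semigroup_def)
  have le: "- S \<subseteq> {..F}"
    using gap_le_frobenius[OF S] by auto
  have "card (- S \<union> (S \<inter> {..F})) = genus S + card (S \<inter> {..F})"
    using fin unfolding genus_def by (intro card_Un_disjoint) auto
  moreover have "- S \<union> (S \<inter> {..F}) = {..F}" using le by auto
  ultimately show ?thesis by simp
qed

lemma reflection_of_member:
  assumes S: "S \<in> semigroups_with F m" and "s \<in> S" "s \<le> F"
  shows "F - s \<notin> S"
proof
  assume "F - s \<in> S"
  then have "s + (F - s) \<in> S"
    using S \<open>s \<in> S\<close> unfolding semigroups_with_iff numerical_semigroup_def by blast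
  then show False using S \<open>s \<le> F\<close> by (simp add: semigroups_with_iff)
qed

lemma reflection_inj: "inj_on (\<lambda>x. F - x) {..F :: nat}"
  by (auto simp: inj_on_def)

lemma genus_lower_bound:
  assumes S: "S \<in> semigroups_with F m"
  shows "F + 1 \<le> 2 * genus S"
proof -
  have "finite (- S)" using S by (simp add: semigroups_with_iff numerical_semigroup_def)
  then have "card (S \<inter> {..F}) \<le> genus S"
    unfolding genus_def
    using reflection_of_member[OF S]
    by (intro card_inj_on_le[OF inj_on_subset[OF reflection_inj[of F]]]) auto
  then show ?thesis using genus_plus_small_members[OF S] by simp
qed

text \<open>For even \<open>F\<close> the fixed point \<open>F / 2\<close> of the reflection is a gap, since its double
is \<open>F\<close>; this single unmatched gap is the parity correction in the count.\<close>

lemma genus_of_paired: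
  assumes S: "S \<in> semigroups_with F m"
    and paired: "\<And>x. x \<notin> S \<Longrightarrow> 2 * x \<noteq> F \<Longrightarrow> F - x \<in> S"
  shows "2 * genus S = (if even F then F + 2 else F + 1)"
proof -
  let ?mid = "{x. 2 * x = F}"
  have fin: "finite (- S)"
    using S by (simp add: semigroups_with_iff numerical_semigroup_def)
  have le: "- S \<subseteq> {..F}"
    using gap_le_frobenius[OF S] by auto
  have mid: "?mid \<subseteq> - S"
    using reflection_of_member[OF S] by fastforce
  have "bij_betw (\<lambda>x. F - x) (S \<inter> {..F}) (- S - ?mid)"
  proof (rule bij_betw_byWitness[where f' = "\<lambda>x. F - x"])
    show "(\<lambda>x. F - x) ` (S \<inter> {..F}) \<subseteq> - S - ?mid"
    proof (rule image_subsetI)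
      fix s assume "s \<in> S \<inter> {..F}"
      then have s: "s \<in> S" "s \<le> F" by auto
      then have "F - s \<notin> S" by (rule reflection_of_member[OF S])
      moreover from this s have "2 * (F - s) \<noteq> F"
        by (metis add_diff_cancel_right' add_diff_inverse_nat mult_2 not_less)
      ultimately show "F - s \<in> - S - ?mid" by simp
    qed
    show "(\<lambda>x. F - x) ` (- S - ?mid) \<subseteq> S \<inter> {..F}" using paired by auto
  qed (use le in auto)
  then have "card (S \<inter> {..F}) = card (- S - ?mid)" by (rule bij_betw_same_card)
  also have "\<dots> = genus S - card ?mid"
    using mid fin by (simp add: genus_def card_Diff_subset finite_subset)
  finally have "card (S \<inter> {..F}) = genus S - card ?mid" .
  moreover have "card ?mid \<le> genus S" using mid fin by (simp add: genus_def card_mono)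
  moreover have "card ?mid = (if even F then 1 else 0)"
  proof (cases "even F")
    case True
    then have "?mid = {F div 2}" by auto
    then show ?thesis using True by simp
  next
    case False
    then have "?mid = {}" by auto
    then show ?thesis using False by simp
  qed
  ultimately show ?thesis using genus_plus_small_members[OF S] by (auto split: if_splits)
qed

text \<open>A gap \<open>x + s\<close> with \<open>0 < s \<in> S\<close> would lie above \<open>x\<close>, so its reflection
\<open>F - x - s\<close> would be a member, and adding \<open>s\<close> back would put \<open>F - x\<close> in
\<open>S\<close>. The remaining new sum \<open>x + x\<close> exceeds \<open>F\<close>.\<close>

lemma adjoin_largest_unpaired_gap:
  assumes S: "S \<in> semigroups_with F m"
    and gap: "x \<notin> S" "F - x \<notin> S" and big: "F < 2 * x" "m \<le> x"
    and largest: "\<And>y. x < y \<Longrightarrow> y \<notin> S \<Longrightarrow> F - y \<in> S"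
  shows "insert x S \<in> semigroups_with F m"
proof -
  have ns: "0 \<in> S" "finite (- S)" "F \<notin> S" "\<And>n. F < n \<Longrightarrow> n \<in> S"
    and add: "\<And>a b. a \<in> S \<Longrightarrow> b \<in> S \<Longrightarrow> a + b \<in> S"
    using S by (auto simp: semigroups_with_iff numerical_semigroup_def)
  have xF: "x \<noteq> F" using gap(2) ns(1) by auto
  have shift: "x + s \<in> insert x S" if s: "s \<in> S" for s
  proof (rule ccontr)
    assume n: "x + s \<notin> insert x S"
    then have "x < x + s" "x + s \<le> F" using ns(4)[of "x + s"] by (cases "s = 0"; force)+
    moreover from this n largest have "F - (x + s) \<in> S" by blast
    ultimately have "F - x \<in> S" using add[OF _ s, of "F - (x + s)"] by simp
    with gap(2) show False ..
  qed
  have "x + x \<in> S" using big by (intro ns(4)) simp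
  then have "a + b \<in> insert x S" if "a \<in> insert x S" "b \<in> insert x S" for a b
    using that shift add by (metis add.commute insert_iff)
  moreover have "finite (- insert x S)" using ns(2) by (rule rev_finite_subset) auto
  ultimately have "numerical_semigroup (insert x S)"
    using ns(1) unfolding numerical_semigroup_def by blast
  then show ?thesis using S xF big by (auto simp: semigroups_with_iff)
qed

section \<open>Large Frobenius number: maximality is minimal genus\<close>

lemma gaps_paired_if_maximal:
  assumes max: "S \<in> maximal_elements (semigroups_with F m)" and "2 * m < F"
    and x: "x \<notin> S" "2 * x \<noteq> F"
  shows "F - x \<in> S"
proof (rule ccontr)
  assume "F - x \<notin> S"
  have S: "S \<in> semigroups_with F m" using max by (simp add: maximal_elements_def)
  note le = gap_le_frobenius[OF S]
  let ?U = "{y. y \<notin> S \<and> F - y \<notin> S \<and> 2 * y \<noteq> F}"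
  have fin: "finite ?U" by (rule finite_subset[of _ "{..F}"]) (use le in auto)
  have xU: "x \<in> ?U" using x \<open>F - x \<notin> S\<close> by simp
  (* The unpaired gaps are symmetric about F / 2, so the largest one lies in the upper half. *)
  have x'U: "F - x \<in> ?U"
    using x \<open>F - x \<notin> S\<close> le[of x] by auto
  define y where "y = Max ?U"
  have "y \<in> ?U" using Max_in[OF fin] xU unfolding y_def by blast
  then have y: "y \<notin> S" "F - y \<notin> S" by simp_all
  have "x \<le> y" "F - x \<le> y" using Max_ge[OF fin] xU x'U unfolding y_def by blast+
  then have "F \<le> 2 * y" using le[of x] x by linarith
  then have big: "F < 2 * y" using \<open>y \<in> ?U\<close> by auto
  have "insert y S \<in> semigroups_with F m"
  proof (rule adjoin_largest_unpaired_gap[OF S y big])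
    show "m \<le> y" using big \<open>2 * m < F\<close> by linarith
    fix z assume "y < z" "z \<notin> S"
    then have "z \<notin> ?U" using Max_ge[OF fin, of z] unfolding y_def by linarith
    then show "F - z \<in> S" using \<open>z \<notin> S\<close> \<open>y < z\<close> big by auto
  qed
  then have "insert y S = S" using max unfolding maximal_elements_def by blast
  then show False using y by auto
qed

lemma maximal_iff_genus_of_large_frobenius:
  assumes S: "S \<in> semigroups_with F m" and "2 * m < F"
  shows "S \<in> maximal_elements (semigroups_with F m) \<longleftrightarrow>
           2 * genus S = (if even F then F + 2 else F + 1)"
proof
  assume "S \<in> maximal_elements (semigroups_with F m)"
  from gaps_paired_if_maximal[OF this \<open>2 * m < F\<close>]
  show "2 * genus S = (if even F then F + 2 else F + 1)"
    by (intro genus_of_paired[OF S])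
next
  assume g: "2 * genus S = (if even F then F + 2 else F + 1)"
  have ns: "numerical_semigroup S" using S by (simp add: semigroups_with_iff)
  have "T = S" if T: "T \<in> semigroups_with F m" and "S \<subseteq> T" for T
  proof -
    have "genus T \<le> genus S"
      using ns \<open>S \<subseteq> T\<close> by (auto simp: genus_def numerical_semigroup_def intro: card_mono)
    (* For even F the lower bound on 2 * genus T is odd and so is never attained. *)
    moreover have "genus S \<le> genus T"
      using g genus_lower_bound[OF T] by (auto split: if_splits)
    ultimately show "T = S" by (intro eq_if_subset_if_genus_eq[OF ns \<open>S \<subseteq> T\<close>]) simp
  qed
  then show "S \<in> maximal_elements (semigroups_with F m)"
    using S by (simp add: maximal_elements_def)
qed

lemma eq_ceiling_half_Suc_iff:
  "int g = \<lceil>(real F + 1) / 2\<rceil> \<longleftrightarrow> 2 * g = (if even F then F + 2 else F + 1)"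
proof (cases "even F")
  case True
  then obtain k where "F = 2 * k" ..
  moreover from this have "\<lceil>(real F + 1) / 2\<rceil> = int k + 1" by (intro ceiling_unique) auto
  ultimately show ?thesis by auto
next
  case False
  then obtain k where "F = 2 * k + 1" by (rule oddE)
  moreover from this have "\<lceil>(real F + 1) / 2\<rceil> = int k + 1" by (intro ceiling_unique) auto
  ultimately show ?thesis by auto
qed

section \<open>The characterization of maximality by genus\<close>

theorem corollary4p5:
  fixes F m :: nat and S :: "nat set"
  assumes "F > 0" and "m > 0"
    and "S \<in> semigroups_with F m"
  shows "S \<in> maximal_elements (semigroups_with F m) \<longleftrightarrow>
      (F = m - 1 \<and> genus S = m - 1)
    \<or> (m < F \<and> F < 2 * m \<and> genus S = m)
    \<or> (F > 2 * m \<and> int (genus S) = \<lceil>(real F + 1) / 2\<rceil>)"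
proof -
  have "F \<noteq> m" "F \<noteq> 2 * m" "m \<le> F + 1"
    using frobenius_not_multiple[OF assms(3)] frobenius_ge[OF assms(3)] by auto
  then consider "F = m - 1" "F < 2 * m" | "m < F" "F < 2 * m" | "2 * m < F"
    using \<open>m > 0\<close> by linarith
  then show ?thesis
  proof cases
    case 1
    then show ?thesis
      using maximal_iff_genus_of_small_frobenius[OF assms(3)] \<open>m > 0\<close> by auto
  next
    case 2
    then show ?thesis
      using maximal_iff_genus_of_small_frobenius[OF assms(3)] by auto
  next
    case 3
    then show ?thesis
      using maximal_iff_genus_of_large_frobenius[OF assms(3)] eq_ceiling_half_Suc_iff[of "genus S" F]
      by auto
  qed
qed

end
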